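(* Let $\mathcal{M}=\{\mathbf{M}^{(\lambda)}:\lambda>0\}$ and $\mathcal{N}=\{\mathbf{N}^{(\lambda)}:\lambda>0\}$ be weight matrices (of sequences indexed by $\mathbb{N}_0^d$) and consider the following assertions: (i) $\mathcal{M}\{\preceq\}\mathcal{N}$; (ii) $\mathcal{S}_{\{\mathcal{M}\}}(\mathbb{R}^d)\subseteq\mathcal{S}_{\{\mathcal{N}\}}(\mathbb{R}^d)$ holds with continuous inclusion. Then (i)$\Rightarrow$(ii) is valid for all dimensions $d\in\mathbb{N}$, and the classes in (ii) can be defined by joint or separated growth at infinity. If (ii) holds for the case $d=1$ and both matrices are standard log-convex and satisfy the conditions (R1) and (R2) below, then (ii)$\Rightarrow$(i) is valid, too. Here, for a weight matrix $\mathcal{M}$: (R1) $\forall\lambda>0\ \exists\kappa\ge\lambda,\ B,C,H>0\ \forall\alpha,\beta\in\mathbb{N}_0^d:\ \alpha^{\alpha/2}M^{(\lambda)}_\beta\le BC^{|\alpha|}H^{|\alpha+\beta|}M^{(\kappa)}_{\alpha+\beta}$; (R2) $\forall\lambda>0\ \exists\kappa\ge\lambda,\ A\ge 1\ \forall\alpha\in\mathbb{N}_0^d,\ 1\le j\le d:\ M^{(\lambda)}_{\alpha+e_j}\le A^{|\alpha|+1}M^{(\kappa)}_\alpha$.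
   Context: $\mathbb{N}_0=\mathbb{N}\cup\{0\}$; $\alpha^{\alpha/2}=\prod_j\alpha_j^{\alpha_j/2}$ with $0^0=1$; $e_j$ is the $j$-th unit vector. A weight matrix is a family $\mathcal{M}=(\mathbf{M}^{(\lambda)})_{\lambda>0}$ of sequences $\mathbf{M}^{(\lambda)}=(M^{(\lambda)}_\alpha)_{\alpha\in\mathbb{N}_0^d}$ of positive reals with $M^{(\lambda)}_0=1$ and $M^{(\lambda)}_\alpha\le M^{(\kappa)}_\alpha$ for all $\alpha$ whenever $0<\lambda\le\kappa$. For $d=1$ it is standard log-convex if each $\mathbf{M}^{(\lambda)}\in\mathcal{LC}$, where $\mathcal{LC}$ is the set of positive sequences $(M_p)_{p\in\mathbb{N}_0}$ with $M_1\ge M_0=1$, $M_p^2\le M_{p-1}M_{p+1}$ for $p\ge 1$, and $\lim_{p\to\infty}(M_p)^{1/p}=\infty$. $\mathbf{M}\preceq\mathbf{N}$ means: there is $C\ge 1$ with $M_\alpha\le C^{|\alpha|}N_\alpha$ for all $\alpha$. $\mathcal{M}\{\preceq\}\mathcal{N}$ means: $\forall\lambda>0\ \exists\kappa>0:\ \mathbf{M}^{(\lambda)}\preceq\mathbf{N}^{(\kappa)}$. For $f\in C^\infty(\mathbb{R}^d)$ and $h>0$ put $\|f\|_{\infty,\mathbf{M},h}:=\sup_{\alpha,\beta\in\mathbb{N}_0^d}\frac{\|x^\alpha\partial^\beta f\|_\infty}{h^{|\alpha+\beta|}M_{\alpha+\beta}}$ ($\|\cdot\|_\infty$ is the supremum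 norm on $\mathbb{R}^d$). $\mathcal{S}_{\{\mathcal{M}\}}(\mathbb{R}^d)$ is the space of all $f\in C^\infty(\mathbb{R}^d)$ with $\|f\|_{\infty,\mathbf{M}^{(\lambda)},h}<\infty$ for some $\lambda,h>0$, with the inductive limit topology. This is the definition by joint growth at infinity; in the definition by separated growth at infinity, $M^{(\lambda)}_{\alpha+\beta}$ is replaced by $M^{(\lambda)}_\alpha M^{(\lambda)}_\beta$ in the seminorms. *)

theory Defs
  imports "HOL-Analysis.Analysis"
begin

section \<open>Multi-indices and smooth functions\<close>

text \<open>Multi-indices in \<open>d\<close> variables are vectors of type \<^typ>\<open>nat ^ 'n\<close> with \<open>d = CARD('n)\<close>;
  addition and \<open>0\<close> are componentwise and \<open>axis j 1\<close> is the unit vector \<open>e\<^sub>j\<close>.\<close>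

definition mi_abs :: "nat ^ 'n::finite \<Rightarrow> nat" where
  "mi_abs \<alpha> = (\<Sum>j\<in>UNIV. \<alpha> $ j)"

definition monomial :: "real ^ 'n::finite \<Rightarrow> nat ^ 'n \<Rightarrow> real" where
  "monomial x \<alpha> = (\<Prod>j\<in>UNIV. (x $ j) ^ (\<alpha> $ j))"

text \<open>\<open>\<alpha>\<^bsup>\<alpha>/2\<^esup>\<close>; the case distinction is the convention \<open>0\<^sup>0 = 1\<close>, since \<open>0 powr 0 = 0\<close> in HOL.\<close>

definition mi_half_power :: "nat ^ 'n::finite \<Rightarrow> real" where
  "mi_half_power \<alpha> =
     (\<Prod>j\<in>UNIV. if \<alpha> $ j = 0 then 1 else real (\<alpha> $ j) powr (real (\<alpha> $ j) / 2))"

definition partial :: "'n::finite \<Rightarrow> (real ^ 'n \<Rightarrow> complex) \<Rightarrow> real ^ 'n \<Rightarrow> complex" where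
  "partial j f = (\<lambda>x. frechet_derivative f (at x) (axis j 1))"

text \<open>\<open>f\<close> is \<open>C\<^sup>\<infinity>\<close> iff all its iterated partial derivatives, taken in any order, exist and are
  (totally) differentiable everywhere; continuity of all of them is then automatic.\<close>

definition smooth :: "(real ^ 'n::finite \<Rightarrow> complex) \<Rightarrow> bool" where
  "smooth f \<longleftrightarrow> (\<forall>js x. foldr partial js f differentiable (at x))"

text \<open>\<open>\<partial>\<^sup>\<beta> f\<close> differentiates \<open>\<beta>\<^sub>j\<close> times in direction \<open>j\<close>, the directions being taken in one
  order fixed for each \<open>\<beta>\<close>. For smooth \<open>f\<close> this order is irrelevant by Schwarz's theorem.\<close>

definition mi_list :: "nat ^ 'n::finite \<Rightarrow> 'n list" where
  "mi_list \<beta> = (SOME js. \<forall>j. count_list js j = \<beta> $ j)"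

definition mi_deriv :: "nat ^ 'n::finite \<Rightarrow> (real ^ 'n \<Rightarrow> complex) \<Rightarrow> real ^ 'n \<Rightarrow> complex" where
  "mi_deriv \<beta> f = foldr partial (mi_list \<beta>) f"

lemma count_list_mi_list: "count_list (mi_list \<beta>) j = \<beta> $ j"
proof -
  have "\<exists>js. \<forall>j. count_list js j = (if j \<in> A then \<beta> $ j else 0)" if "finite A" for A
    using that
  proof (induction A rule: finite_induct)
    case empty
    show ?case by (rule exI[of _ "[]"]) simp
  next
    case (insert i A)
    then obtain js where js: "\<forall>j. count_list js j = (if j \<in> A then \<beta> $ j else 0)"
      by blast
    have rep: "count_list (replicate k i) j = (if j = i then k else 0)" for j k
      by (induction k) auto
    show ?case
      using insert.hyps js
      by (intro exI[of _ "replicate (\<beta> $ i) i @ js"]) (auto simp: rep)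
  qed
  from this[of UNIV] have "\<exists>js. \<forall>j. count_list js j = \<beta> $ j"
    by simp
  then show ?thesis
    unfolding mi_list_def by (rule someI2_ex) blast
qed


section \<open>Weight matrices\<close>

text \<open>A family \<open>(M\<^sup>(\<^sup>\<lambda>\<^sup>))\<close>, \<open>\<lambda> > 0\<close>, is a function of \<open>\<lambda> :: real\<close>; values at \<open>\<lambda> \<le> 0\<close> are never used.\<close>

definition weight_matrix :: "(real \<Rightarrow> nat ^ 'n::finite \<Rightarrow> real) \<Rightarrow> bool" where
  "weight_matrix M \<longleftrightarrow>
     (\<forall>l>0. \<forall>\<alpha>. M l \<alpha> > 0) \<and>
     (\<forall>l>0. M l 0 = 1) \<and>
     (\<forall>l k. 0 < l \<and> l \<le> k \<longrightarrow> (\<forall>\<alpha>. M l \<alpha> \<le> M k \<alpha>))"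

definition LC :: "(nat \<Rightarrow> real) set" where
  "LC = {M. (\<forall>p. M p > 0) \<and> M 0 = 1 \<and> M 1 \<ge> M 0 \<and>
            (\<forall>p\<ge>1. (M p)\<^sup>2 \<le> M (p - 1) * M (p + 1)) \<and>
            filterlim (\<lambda>p. M p powr (1 / real p)) at_top sequentially}"

text \<open>Only meant for \<open>CARD('n) = 1\<close>, where \<open>p \<mapsto> vec p\<close> identifies \<open>\<nat>\<^sub>0\<close> with the multi-indices.\<close>

definition standard_log_convex :: "(real \<Rightarrow> nat ^ 'n::finite \<Rightarrow> real) \<Rightarrow> bool" where
  "standard_log_convex M \<longleftrightarrow> (\<forall>l>0. (\<lambda>p. M l (vec p)) \<in> LC)"

definition seq_le :: "(nat ^ 'n::finite \<Rightarrow> real) \<Rightarrow> (nat ^ 'n \<Rightarrow> real) \<Rightarrow> bool" where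
  "seq_le M N \<longleftrightarrow> (\<exists>C\<ge>1. \<forall>\<alpha>. M \<alpha> \<le> C ^ mi_abs \<alpha> * N \<alpha>)"

definition matrix_le ::
    "(real \<Rightarrow> nat ^ 'n::finite \<Rightarrow> real) \<Rightarrow> (real \<Rightarrow> nat ^ 'n \<Rightarrow> real) \<Rightarrow> bool" where
  "matrix_le M N \<longleftrightarrow> (\<forall>l>0. \<exists>k>0. seq_le (M l) (N k))"

definition R1 :: "(real \<Rightarrow> nat ^ 'n::finite \<Rightarrow> real) \<Rightarrow> bool" where
  "R1 M \<longleftrightarrow> (\<forall>l>0. \<exists>k\<ge>l. \<exists>B>0. \<exists>C>0. \<exists>H>0. \<forall>\<alpha> \<beta>.
     mi_half_power \<alpha> * M l \<beta> \<le> B * C ^ mi_abs \<alpha> * H ^ mi_abs (\<alpha> + \<beta>) * M k (\<alpha> + \<beta>))"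

definition R2 :: "(real \<Rightarrow> nat ^ 'n::finite \<Rightarrow> real) \<Rightarrow> bool" where
  "R2 M \<longleftrightarrow> (\<forall>l>0. \<exists>k\<ge>l. \<exists>A\<ge>1. \<forall>\<alpha> j.
     M l (\<alpha> + axis j 1) \<le> A ^ (mi_abs \<alpha> + 1) * M k \<alpha>)"


section \<open>The spaces and their inductive limit topology\<close>

datatype growth = Joint | Separated

primrec growth_weight :: "growth \<Rightarrow> (nat ^ 'n::finite \<Rightarrow> real) \<Rightarrow> nat ^ 'n \<Rightarrow> nat ^ 'n \<Rightarrow> real" where
  "growth_weight Joint M \<alpha> \<beta> = M (\<alpha> + \<beta>)"
| "growth_weight Separated M \<alpha> \<beta> = M \<alpha> * M \<beta>"

definition sup_norm :: "('a \<Rightarrow> complex) \<Rightarrow> ennreal" where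
  "sup_norm f = (SUP x. ennreal (norm (f x)))"

definition S_norm ::
    "growth \<Rightarrow> (nat ^ 'n::finite \<Rightarrow> real) \<Rightarrow> real \<Rightarrow> (real ^ 'n \<Rightarrow> complex) \<Rightarrow> ennreal" where
  "S_norm g M h f = (SUP (\<alpha>, \<beta>). sup_norm (\<lambda>x. of_real (monomial x \<alpha>) * mi_deriv \<beta> f x)
                          / ennreal (h ^ mi_abs (\<alpha> + \<beta>) * growth_weight g M \<alpha> \<beta>))"

definition S_step :: "growth \<Rightarrow> (nat ^ 'n::finite \<Rightarrow> real) \<Rightarrow> real \<Rightarrow> (real ^ 'n \<Rightarrow> complex) set" where
  "S_step g M h = {f. smooth f \<and> S_norm g M h f < \<infinity>}"

definition S_space :: "growth \<Rightarrow> (real \<Rightarrow> nat ^ 'n::finite \<Rightarrow> real) \<Rightarrow> (real ^ 'n \<Rightarrow> complex) set" where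
  "S_space g M = {f. smooth f \<and> (\<exists>l>0. \<exists>h>0. S_norm g (M l) h f < \<infinity>)}"

definition absolutely_convex :: "('a \<Rightarrow> complex) set \<Rightarrow> bool" where
  "absolutely_convex U \<longleftrightarrow>
     (\<forall>f\<in>U. \<forall>g\<in>U. \<forall>a b. norm a + norm b \<le> 1 \<longrightarrow> (\<lambda>x. a * f x + b * g x) \<in> U)"

text \<open>The inductive limit is taken in the category of locally convex spaces, over the normed
  steps \<^term>\<open>S_step g (M l) h\<close> with \<open>l, h > 0\<close>: a basis of zero neighbourhoods is given by the
  absolutely convex subsets meeting every step in a zero neighbourhood of that step.\<close>

definition S_zero_nbhd ::
    "growth \<Rightarrow> (real \<Rightarrow> nat ^ 'n::finite \<Rightarrow> real) \<Rightarrow> (real ^ 'n \<Rightarrow> complex) set \<Rightarrow> bool" where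
  "S_zero_nbhd g M U \<longleftrightarrow> U \<subseteq> S_space g M \<and> absolutely_convex U \<and>
     (\<forall>l>0. \<forall>h>0. \<exists>e>0. \<forall>f\<in>S_step g (M l) h. S_norm g (M l) h f < ennreal e \<longrightarrow> f \<in> U)"

definition S_open ::
    "growth \<Rightarrow> (real \<Rightarrow> nat ^ 'n::finite \<Rightarrow> real) \<Rightarrow> (real ^ 'n \<Rightarrow> complex) set \<Rightarrow> bool" where
  "S_open g M W \<longleftrightarrow> W \<subseteq> S_space g M \<and>
     (\<forall>f\<in>W. \<exists>U. S_zero_nbhd g M U \<and> (\<forall>u\<in>U. (\<lambda>x. f x + u x) \<in> W))"

definition S_topology ::
    "growth \<Rightarrow> (real \<Rightarrow> nat ^ 'n::finite \<Rightarrow> real) \<Rightarrow> (real ^ 'n \<Rightarrow> complex) topology" where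
  "S_topology g M = topology (S_open g M)"

lemma S_zero_nbhd_Int:
  assumes "S_zero_nbhd g M U" "S_zero_nbhd g M V"
  shows "S_zero_nbhd g M (U \<inter> V)"
  unfolding S_zero_nbhd_def
proof (intro conjI allI impI)
  show "U \<inter> V \<subseteq> S_space g M" "absolutely_convex (U \<inter> V)"
    using assms unfolding S_zero_nbhd_def absolutely_convex_def by blast+
  fix l h :: real assume "l > 0" "h > 0"
  then have "\<exists>e>0. \<forall>f\<in>S_step g (M l) h. S_norm g (M l) h f < ennreal e \<longrightarrow> f \<in> U"
    "\<exists>e>0. \<forall>f\<in>S_step g (M l) h. S_norm g (M l) h f < ennreal e \<longrightarrow> f \<in> V"
    using assms unfolding S_zero_nbhd_def by simp_all
  then obtain d e where "d > 0" "e > 0"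
    and d: "\<forall>f\<in>S_step g (M l) h. S_norm g (M l) h f < ennreal d \<longrightarrow> f \<in> U"
    and e: "\<forall>f\<in>S_step g (M l) h. S_norm g (M l) h f < ennreal e \<longrightarrow> f \<in> V"
    by (elim exE conjE)
  have "ennreal (min d e) \<le> ennreal d" "ennreal (min d e) \<le> ennreal e"
    by (auto intro: ennreal_leI)
  then have "f \<in> U \<inter> V" if "f \<in> S_step g (M l) h" "S_norm g (M l) h f < ennreal (min d e)" for f
    using that d e by (meson IntI order_less_le_trans)
  moreover have "min d e > 0"
    using \<open>d > 0\<close> \<open>e > 0\<close> by simp
  ultimately show "\<exists>e>0. \<forall>f\<in>S_step g (M l) h. S_norm g (M l) h f < ennreal e \<longrightarrow> f \<in> U \<inter> V"
    by blast
qed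

lemma openin_S_topology: "openin (S_topology g M) = S_open g M"
  unfolding S_topology_def
proof (rule topology_inverse', unfold istopology_def, intro conjI allI impI)
  fix V W assume V: "S_open g M V" and W: "S_open g M W"
  show "S_open g M (V \<inter> W)"
    unfolding S_open_def
  proof (intro conjI ballI)
    show "V \<inter> W \<subseteq> S_space g M" using V unfolding S_open_def by blast
    fix f assume "f \<in> V \<inter> W"
    then obtain U1 U2 where "S_zero_nbhd g M U1" "\<forall>u\<in>U1. (\<lambda>x. f x + u x) \<in> V"
      "S_zero_nbhd g M U2" "\<forall>u\<in>U2. (\<lambda>x. f x + u x) \<in> W"
      using V W unfolding S_open_def by blast
    then show "\<exists>U. S_zero_nbhd g M U \<and> (\<forall>u\<in>U. (\<lambda>x. f x + u x) \<in> V \<inter> W)"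
      by (intro exI[of _ "U1 \<inter> U2"]) (auto intro: S_zero_nbhd_Int)
  qed
next
  fix K assume K: "\<forall>W\<in>K. S_open g M W"
  show "S_open g M (\<Union>K)"
    unfolding S_open_def
  proof (intro conjI ballI)
    show "\<Union>K \<subseteq> S_space g M" using K unfolding S_open_def by blast
    fix f assume "f \<in> \<Union>K"
    then obtain W where W: "W \<in> K" "f \<in> W" by blast
    then obtain U where "S_zero_nbhd g M U" "\<forall>u\<in>U. (\<lambda>x. f x + u x) \<in> W"
      using K unfolding S_open_def by blast
    with W show "\<exists>U. S_zero_nbhd g M U \<and> (\<forall>u\<in>U. (\<lambda>x. f x + u x) \<in> \<Union>K)" by blast
  qed
qed

lemma foldr_partial_lincomb:
  assumes "smooth f" "smooth g"
  shows "foldr partial js (\<lambda>x. a * f x + b * g x) =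
    (\<lambda>x. a * foldr partial js f x + b * foldr partial js g x)"
proof (induction js)
  case (Cons j js)
  have "partial j (\<lambda>x. a * foldr partial js f x + b * foldr partial js g x) y =
      a * partial j (foldr partial js f) y + b * partial j (foldr partial js g) y" for y
  proof -
    have f: "(foldr partial js f has_derivative frechet_derivative (foldr partial js f) (at y)) (at y)"
      and g: "(foldr partial js g has_derivative frechet_derivative (foldr partial js g) (at y)) (at y)"
      using assms by (auto simp: smooth_def frechet_derivative_works)
    have "((\<lambda>x. a * foldr partial js f x + b * foldr partial js g x) has_derivative
       (\<lambda>h. a * frechet_derivative (foldr partial js f) (at y) h
          + b * frechet_derivative (foldr partial js g) (at y) h)) (at y)"
      by (intro derivative_intros f g)
    from fun_cong[OF frechet_derivative_at[OF this], of "axis j 1"] show ?thesis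
      by (simp add: partial_def)
  qed
  then show ?case using Cons by auto
qed auto

lemma smooth_lincomb:
  assumes "smooth f" "smooth g"
  shows "smooth (\<lambda>x. a * f x + b * g x)"
  using assms unfolding smooth_def foldr_partial_lincomb[OF assms]
  by (auto intro!: derivative_intros)

lemma growth_weight_pos:
  assumes "weight_matrix M" "l > 0"
  shows "growth_weight g (M l) \<alpha> \<beta> > 0"
  using assms by (cases g) (auto simp: weight_matrix_def)

lemma growth_weight_mono:
  assumes "weight_matrix M" "0 < l" "l \<le> k"
  shows "growth_weight g (M l) \<alpha> \<beta> \<le> growth_weight g (M k) \<alpha> \<beta>"
proof -
  have "M l \<alpha> \<le> M k \<alpha>" "M l \<beta> \<le> M k \<beta>" "M l (\<alpha>+\<beta>) \<le> M k (\<alpha>+\<beta>)" "0 < M k \<alpha>" "0 < M l \<beta>"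
    using assms by (auto simp: weight_matrix_def)
  then show ?thesis by (cases g) (auto intro: mult_mono)
qed

lemma S_norm_finite_iff:
  assumes "weight_matrix M" "l > 0" "h > 0"
  shows "S_norm g (M l) h f < \<infinity> \<longleftrightarrow>
    (\<exists>C. \<forall>\<alpha> \<beta> x. norm (of_real (monomial x \<alpha>) * mi_deriv \<beta> f x)
           \<le> C * (h ^ mi_abs (\<alpha> + \<beta>) * growth_weight g (M l) \<alpha> \<beta>))"
    (is "_ \<longleftrightarrow> (\<exists>C. \<forall>\<alpha> \<beta> x. ?n \<alpha> \<beta> x \<le> C * ?w \<alpha> \<beta>)")
proof -
  have w: "?w \<alpha> \<beta> > 0" for \<alpha> \<beta>
    using assms by (simp add: growth_weight_pos)
  have key: "S_norm g (M l) h f \<le> ennreal C \<longleftrightarrow> (\<forall>\<alpha> \<beta> x. ?n \<alpha> \<beta> x \<le> C * ?w \<alpha> \<beta>)" if "C \<ge> 0" for C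
  proof -
    have "sup_norm (\<lambda>x. of_real (monomial x \<alpha>) * mi_deriv \<beta> f x) / ennreal (?w \<alpha> \<beta>) \<le> ennreal C
       \<longleftrightarrow> (\<forall>x. ?n \<alpha> \<beta> x \<le> C * ?w \<alpha> \<beta>)" for \<alpha> \<beta>
    proof -
      have *: "s / ennreal v \<le> ennreal C \<longleftrightarrow> s \<le> ennreal (C * v)" if "v > 0" for s v
        using that \<open>C \<ge> 0\<close>
        by (cases s) (auto simp: divide_ennreal ennreal_top_divide top_unique field_simps)
      show ?thesis
        using w[of \<alpha> \<beta>] \<open>C \<ge> 0\<close>
        by (auto simp: * sup_norm_def SUP_le_iff simp del: norm_mult)
    qed
    then show ?thesis by (auto simp: S_norm_def SUP_le_iff)
  qed
  show ?thesis
  proof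
    assume "S_norm g (M l) h f < \<infinity>"
    then obtain C where "C \<ge> 0" "S_norm g (M l) h f = ennreal C"
      by (cases "S_norm g (M l) h f") auto
    with key[of C] show "\<exists>C. \<forall>\<alpha> \<beta> x. ?n \<alpha> \<beta> x \<le> C * ?w \<alpha> \<beta>" by auto
  next
    assume "\<exists>C. \<forall>\<alpha> \<beta> x. ?n \<alpha> \<beta> x \<le> C * ?w \<alpha> \<beta>"
    then obtain C where C: "\<And>\<alpha> \<beta> x. ?n \<alpha> \<beta> x \<le> C * ?w \<alpha> \<beta>" by blast
    have "?n \<alpha> \<beta> x \<le> max C 0 * ?w \<alpha> \<beta>" for \<alpha> \<beta> x
      using C[of x \<alpha> \<beta>] w[of \<alpha> \<beta>] mult_right_mono[of C "max C 0" "?w \<alpha> \<beta>"] by linarith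
    then have "S_norm g (M l) h f \<le> ennreal (max C 0)"
      using key[of "max C 0"] by auto
    then show "S_norm g (M l) h f < \<infinity>"
      by (auto intro: order_le_less_trans)
  qed
qed

lemma S_spaceE:
  assumes "weight_matrix M" "f \<in> S_space g M"
  obtains l h C where "smooth f" "l > 0" "h > 0"
    "\<forall>\<alpha> \<beta> x. norm (of_real (monomial x \<alpha>) * mi_deriv \<beta> f x)
           \<le> C * (h ^ mi_abs (\<alpha> + \<beta>) * growth_weight g (M l) \<alpha> \<beta>)"
proof -
  obtain l h where l: "smooth f" "l > 0" "h > 0" "S_norm g (M l) h f < \<infinity>"
    using assms(2) unfolding S_space_def mem_Collect_eq by (elim conjE exE)
  with S_norm_finite_iff[OF assms(1) l(2,3)] that[OF l(1-3)] show ?thesis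
    by simp blast
qed

lemma S_space_lincomb:
  assumes M: "weight_matrix M" and f: "f \<in> S_space g M" and u: "u \<in> S_space g M"
  shows "(\<lambda>x. a * f x + b * u x) \<in> S_space g M"
proof -
  obtain l h C where sf: "smooth f" and l: "l > 0" "h > 0"
    and C: "\<forall>\<alpha> \<beta> x. norm (of_real (monomial x \<alpha>) * mi_deriv \<beta> f x)
           \<le> C * (h ^ mi_abs (\<alpha> + \<beta>) * growth_weight g (M l) \<alpha> \<beta>)"
    using S_spaceE[OF M f] .
  obtain k i D where su: "smooth u" and k: "k > 0" "i > 0"
    and D: "\<forall>\<alpha> \<beta> x. norm (of_real (monomial x \<alpha>) * mi_deriv \<beta> u x)
           \<le> D * (i ^ mi_abs (\<alpha> + \<beta>) * growth_weight g (M k) \<alpha> \<beta>)"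
    using S_spaceE[OF M u] .
  define m where "m = max l k"
  define r where "r = max h i"
  have m: "m > 0" "r > 0" using l by (auto simp: m_def r_def)
  have mono: "c * (t ^ n * growth_weight g (M p) \<alpha> \<beta>) \<le> \<bar>c\<bar> * (r ^ n * growth_weight g (M m) \<alpha> \<beta>)"
    if "0 < t" "t \<le> r" "0 < p" "p \<le> m" for c t n p \<alpha> \<beta>
    using that m growth_weight_pos[OF M, of p g \<alpha> \<beta>] growth_weight_mono[OF M, of p m g \<alpha> \<beta>]
    by (intro mult_mono power_mono) auto
  have "norm (of_real (monomial x \<alpha>) * mi_deriv \<beta> (\<lambda>x. a * f x + b * u x) x)
     \<le> (norm a * \<bar>C\<bar> + norm b * \<bar>D\<bar>) * (r ^ mi_abs (\<alpha> + \<beta>) * growth_weight g (M m) \<alpha> \<beta>)"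
    (is "?L \<le> (_ * _ + _ * _) * ?R") for \<alpha> \<beta> x
  proof -
    have "of_real (monomial x \<alpha>) * mi_deriv \<beta> (\<lambda>x. a * f x + b * u x) x =
       a * (of_real (monomial x \<alpha>) * mi_deriv \<beta> f x) + b * (of_real (monomial x \<alpha>) * mi_deriv \<beta> u x)"
      by (simp add: mi_deriv_def foldr_partial_lincomb[OF sf su] algebra_simps)
    moreover have "norm (a * p + b * q) \<le> norm a * norm p + norm b * norm q" for p q :: complex
      using norm_triangle_ineq[of "a * p" "b * q"] by (simp add: norm_mult)
    ultimately have "?L \<le> norm a * norm (of_real (monomial x \<alpha>) * mi_deriv \<beta> f x)
        + norm b * norm (of_real (monomial x \<alpha>) * mi_deriv \<beta> u x)"
      by (simp only:)
    also have "\<dots> \<le> norm a * (\<bar>C\<bar> * ?R) + norm b * (\<bar>D\<bar> * ?R)"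
      using l k
      by (intro add_mono mult_left_mono order_trans[OF C[rule_format] mono] order_trans[OF D[rule_format] mono])
         (auto simp: m_def r_def)
    finally show ?thesis by (simp add: algebra_simps)
  qed
  then have "S_norm g (M m) r (\<lambda>x. a * f x + b * u x) < \<infinity>"
    unfolding S_norm_finite_iff[OF M m] by blast
  then show ?thesis
    unfolding S_space_def using m smooth_lincomb[OF sf su] by blast
qed

lemma topspace_S_topology:
  assumes M: "weight_matrix M"
  shows "topspace (S_topology g M) = S_space g M"
proof -
  have "S_zero_nbhd g M (S_space g M)"
    unfolding S_zero_nbhd_def absolutely_convex_def
  proof (intro conjI allI impI ballI)
    fix l h :: real assume "l > 0" "h > 0"
    then have "S_step g (M l) h \<subseteq> S_space g M"
      unfolding S_step_def S_space_def by blast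
    then show "\<exists>e>0. \<forall>f\<in>S_step g (M l) h. S_norm g (M l) h f < ennreal e \<longrightarrow> f \<in> S_space g M"
      by (intro exI[of _ 1]) auto
  qed (auto intro: S_space_lincomb[OF M])
  moreover have "(\<lambda>x. f x + u x) \<in> S_space g M" if "f \<in> S_space g M" "u \<in> S_space g M" for f u
    using S_space_lincomb[OF M that, of 1 1] by simp
  ultimately have "S_open g M (S_space g M)"
    unfolding S_open_def by blast
  then show ?thesis
    by (intro antisym openin_subset)
       (auto simp: topspace_def openin_S_topology S_open_def)
qed

definition continuously_included ::
    "growth \<Rightarrow> (real \<Rightarrow> nat ^ 'n::finite \<Rightarrow> real) \<Rightarrow> (real \<Rightarrow> nat ^ 'n \<Rightarrow> real) \<Rightarrow> bool" where
  "continuously_included g M N \<longleftrightarrow> S_space g M \<subseteq> S_space g N \<and>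
     continuous_map (S_topology g M) (S_topology g N) id"

end

theory Submission
  imports Defs
begin

text \<open>If \<open>M \<alpha> \<le> C\<^bsup>|\<alpha>|\<^esup> N \<alpha>\<close>, then replacing \<open>M\<close> by \<open>N\<close> and \<open>h\<close> by \<open>C h\<close> only lowers the seminorm, for
  either kind of growth (\<open>S_norm_le_of_seq_le\<close>). So every step of the inductive limit for the matrix
  \<open>M\<close> lies in a step for \<open>N\<close> with norm at most \<open>1\<close>, and traces of zero neighbourhoods are zero
  neighbourhoods.

  The converse in one variable rests on a single function for each \<open>l\<close>, which lies in the space
  of \<open>M\<close> while its derivatives at \<open>0\<close> are as large as \<open>M l\<close> up to a geometric factor:
  \<open>f t = exp (-t\<^sup>2/2) \<cdot> (\<Sum>k. 2\<^sup>-\<^sup>k \<cdot> M\<^sub>k / m\<^sub>k\<^sup>k \<cdot> exp (\<i> m\<^sub>k t))\<close> with \<open>m\<^sub>k = M\<^bsub>k+1\<^esub> / M\<^sub>k\<close>,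
  where \<open>M\<^sub>p\<close> stands for \<open>M l p\<close>. Log-convexity says that \<open>p \<mapsto> log M\<^sub>p\<close> has the line of slope
  \<open>log m\<^sub>k\<close> through its point at \<open>k\<close> as a supporting line, that is, \<open>M\<^sub>k m\<^sub>k\<^sup>p \<le> M\<^sub>p m\<^sub>k\<^sup>k\<close>. Hence the
  \<open>p\<close>-th derivative of the series is at most \<open>2 M\<^sub>p\<close> everywhere, while at \<open>0\<close> it is \<open>\<i>\<^sup>p\<close> times a
  sum of positive terms, of which the one for \<open>k = p\<close> is already \<open>2\<^sup>-\<^sup>p M\<^sub>p\<close>.

  The series does not decay, and the Gaussian factor repairs this. It costs nothing that \<open>R1\<close>
  does not pay for: \<open>|t\<^sup>a G\<^sup>(\<^sup>n\<^sup>)(t)|\<close> is at most \<open>4\<^bsup>a+n\<^esup> a\<^bsup>a/2\<^esup> n\<^bsup>n/2\<^esup>\<close>, and \<open>R1\<close> absorbs exactly such half powers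
  into \<open>M \<kappa>\<close> for a suitable \<open>\<kappa> \<ge> l\<close>, once for \<open>t\<^sup>a\<close> and once inside Leibniz' rule.
  Nor does the Gaussian spoil the size at \<open>0\<close>: its \<open>n\<close>-th derivative there is also \<open>\<i>\<^sup>n\<close> times a nonnegative number, so that all terms of
  Leibniz' rule at \<open>0\<close> point in the same direction and none can cancel. The resulting bounds are
  those of separated growth, which imply those of joint growth because \<open>M \<kappa>\<close> is log-convex with
  value \<open>1\<close> at \<open>0\<close> (\<open>log_convex_mult_le_add\<close>). If now \<open>f\<close> also lies in the space of \<open>N\<close>, the
  seminorms at \<open>t = 0\<close> without any factor \<open>t\<close> bound \<open>2\<^sup>-\<^sup>p M\<^sub>p\<close> by \<open>D h\<^sup>p N \<kappa> p\<close> for some \<open>\<kappa>\<close>.\<close>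

section \<open>The Gaussian and its derivatives\<close>

text \<open>\<open>gauss_deriv n\<close> is the \<open>n\<close>-th derivative of \<open>exp (-t\<^sup>2/2)\<close>, that is, a signed Hermite polynomial
  times the Gaussian. The three-term recursion is what both the decay estimate and the values at
  \<open>0\<close> are read off from.\<close>

fun gauss_deriv :: "nat \<Rightarrow> real \<Rightarrow> real" where
  "gauss_deriv 0 t = exp (- (t\<^sup>2 / 2))"
| "gauss_deriv (Suc 0) t = - t * exp (- (t\<^sup>2 / 2))"
| "gauss_deriv (Suc (Suc n)) t = - t * gauss_deriv (Suc n) t - real (Suc n) * gauss_deriv n t"

lemma gauss_deriv_has_real_derivative: "(gauss_deriv n has_real_derivative gauss_deriv (Suc n) t) (at t)"
proof (induction n t rule: gauss_deriv.induct)
  case (1 t)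
  have "gauss_deriv 0 = (\<lambda>t. exp (- (t\<^sup>2 / 2)))" by auto
  then show ?case by (auto intro!: derivative_eq_intros)
next
  case (2 t)
  have "gauss_deriv (Suc 0) = (\<lambda>t. - t * exp (- (t\<^sup>2 / 2)))" by auto
  then show ?case by (auto intro!: derivative_eq_intros simp: power2_eq_square)
next
  case (3 n t)
  have "gauss_deriv (Suc (Suc n)) = (\<lambda>t. - t * gauss_deriv (Suc n) t - real (Suc n) * gauss_deriv n t)" by auto
  moreover have "((\<lambda>t. - t * gauss_deriv (Suc n) t - real (Suc n) * gauss_deriv n t) has_real_derivative
      - 1 * gauss_deriv (Suc n) t + gauss_deriv (Suc (Suc n)) t * - t - real (Suc n) * gauss_deriv (Suc n) t) (at t)"
    using 3 by (auto intro!: derivative_eq_intros simp del: gauss_deriv.simps(3))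
  ultimately show ?case
    by (simp add: algebra_simps)
qed

lemma power_le_fact_exp:
  fixes x :: real
  assumes "x \<ge> 0"
  shows "x ^ n \<le> fact n * exp x"
proof -
  have s: "summable (\<lambda>k. x ^ k /\<^sub>R fact k)" by (rule summable_exp_generic)
  have "(\<Sum>k\<in>{n}. x ^ k /\<^sub>R fact k) \<le> (\<Sum>k. x ^ k /\<^sub>R fact k)"
    by (rule sum_le_suminf[OF s]) (use assms in auto)
  then show ?thesis by (simp add: exp_def field_simps)
qed

text \<open>Both terms of the recursion are compatible with \<open>sqrt ((a + n)!)\<close>: multiplication by \<open>t\<close> trades
  an order of differentiation for a power of \<open>t\<close> and keeps \<open>a + n\<close>, while the factor \<open>n + 1\<close> in the
  other term pays for raising \<open>a + n\<close> by two under the square root.\<close>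

lemma abs_power_mult_gauss_deriv_le:
  "\<bar>t\<bar> ^ a * \<bar>gauss_deriv n t\<bar> \<le> 2 ^ n * sqrt (fact (a + n))"
proof (induction n t arbitrary: a rule: gauss_deriv.induct)
  case (1 t)
  have "(\<bar>t\<bar> ^ a * exp (- (t\<^sup>2 / 2)))\<^sup>2 = (t\<^sup>2) ^ a * exp (- t\<^sup>2)"
    unfolding power_mult_distrib power_mult[symmetric] mult.commute[of a]
    by (simp add: power_mult exp_of_nat_mult[symmetric])
  also have "\<dots> \<le> fact a"
    using power_le_fact_exp[of "t\<^sup>2" a] by (simp add: exp_minus field_simps)
  finally show ?case
    by (simp add: real_le_rsqrt)
next
  case (2 t)
  have "(\<bar>t\<bar> ^ Suc a * exp (- (t\<^sup>2 / 2)))\<^sup>2 = (t\<^sup>2) ^ Suc a * exp (- t\<^sup>2)"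
    unfolding power_mult_distrib power_mult[symmetric] mult.commute[of "Suc a"]
    by (simp add: power_mult exp_of_nat_mult[symmetric] del: power_Suc mult_Suc mult_Suc_right)
  also have "\<dots> \<le> fact (Suc a)"
    using power_le_fact_exp[of "t\<^sup>2" "Suc a"] by (simp add: exp_minus field_simps)
  finally have "\<bar>t\<bar> ^ Suc a * exp (- (t\<^sup>2 / 2)) \<le> sqrt (fact (Suc a))"
    by (rule real_le_rsqrt)
  also have "\<dots> \<le> 2 ^ Suc 0 * sqrt (fact (a + Suc 0))"
    by (simp del: fact_Suc)
  finally show ?case by (simp add: abs_mult algebra_simps del: fact_Suc)
next
  case (3 n t)
  have s: "real (Suc n) * sqrt (fact (a + n)) \<le> sqrt (fact (a + Suc (Suc n)))"
  proof (rule real_le_rsqrt)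
    have "(real (Suc n) * sqrt (fact (a + n)))\<^sup>2 = (real (Suc n) * real (Suc n)) * fact (a + n)"
      by (simp add: power_mult_distrib power2_eq_square del: of_nat_Suc)
    also have "\<dots> \<le> (real (a + Suc (Suc n)) * real (a + Suc n)) * fact (a + n)"
      by (intro mult_right_mono mult_mono) auto
    finally show "(real (Suc n) * sqrt (fact (a + n)))\<^sup>2 \<le> fact (a + Suc (Suc n))"
      by (simp add: algebra_simps)
  qed
  have "\<bar>t\<bar> ^ a * \<bar>gauss_deriv (Suc (Suc n)) t\<bar>
      \<le> \<bar>t\<bar> ^ a * (\<bar>t\<bar> * \<bar>gauss_deriv (Suc n) t\<bar> + real (Suc n) * \<bar>gauss_deriv n t\<bar>)"
    by (intro mult_left_mono) (auto simp: abs_mult intro!: order_trans[OF abs_triangle_ineq4])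
  also have "\<dots> = \<bar>t\<bar> ^ Suc a * \<bar>gauss_deriv (Suc n) t\<bar> + real (Suc n) * (\<bar>t\<bar> ^ a * \<bar>gauss_deriv n t\<bar>)"
    by (simp add: algebra_simps)
  also have "\<dots> \<le> 2 ^ Suc n * sqrt (fact (Suc a + Suc n)) + real (Suc n) * (2 ^ n * sqrt (fact (a + n)))"
    by (intro add_mono mult_left_mono 3) auto
  also have "\<dots> = 2 ^ Suc n * sqrt (fact (a + Suc (Suc n))) + 2 ^ n * (real (Suc n) * sqrt (fact (a + n)))"
    by (simp only: add_Suc add_Suc_right mult.left_commute)
  also have "\<dots> \<le> 2 ^ Suc n * sqrt (fact (a + Suc (Suc n))) + 2 ^ n * sqrt (fact (a + Suc (Suc n)))"
    by (intro add_mono mult_left_mono s) auto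
  also have "\<dots> \<le> 2 ^ Suc (Suc n) * sqrt (fact (a + Suc (Suc n)))"
    by (simp del: fact_Suc)
  finally show ?case .
qed

text \<open>The absolute values of the derivatives of the Gaussian at \<open>0\<close>, which are also the moments of
  the standard normal distribution: \<open>(n - 1)!!\<close> for even \<open>n\<close> and \<open>0\<close> for odd \<open>n\<close>.\<close>

fun gauss_moment :: "nat \<Rightarrow> real" where
  "gauss_moment 0 = 1"
| "gauss_moment (Suc 0) = 0"
| "gauss_moment (Suc (Suc n)) = real (Suc n) * gauss_moment n"

lemma gauss_moment_nonneg: "gauss_moment n \<ge> 0"
  by (induction n rule: gauss_moment.induct) auto

lemma gauss_deriv_0: "complex_of_real (gauss_deriv n 0) = \<i> ^ n * of_real (gauss_moment n)"
  by (induction n rule: gauss_moment.induct) auto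

definition half_power :: "nat \<Rightarrow> real" where
  "half_power n = (if n = 0 then 1 else real n powr (real n / 2))"

lemma half_power_nonneg: "half_power n \<ge> 0"
  by (simp add: half_power_def)

lemma sqrt_fact_le_half_power: "sqrt (fact n) \<le> half_power n"
proof (cases "n = 0")
  case False
  have "(half_power n)\<^sup>2 = real n ^ n"
    using False by (simp add: half_power_def power2_eq_square powr_realpow flip: powr_add)
  then have "fact n \<le> (half_power n)\<^sup>2"
    using fact_le_power[of n, where ?'a = real] by simp
  then show ?thesis
    by (intro real_le_lsqrt half_power_nonneg) auto
qed (simp add: half_power_def)

text \<open>Passing from \<open>(a + n)!\<close> to \<open>a! n!\<close> costs a binomial coefficient, at most \<open>2\<^bsup>a+n\<^esup>\<close>. This separates the
  contributions of \<open>t\<^sup>a\<close> and of the derivative, as separated growth requires.\<close>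

lemma abs_power_mult_gauss_deriv_le_half_power:
  "\<bar>t\<bar> ^ a * \<bar>gauss_deriv n t\<bar> \<le> 4 ^ (a + n) * (half_power a * half_power n)"
proof -
  have "fact (a + n) = fact a * fact n * ((a + n) choose a)"
    using binomial_fact_lemma[of a "a + n"] by simp
  also have "\<dots> \<le> fact a * fact n * 2 ^ (a + n)"
    by (intro mult_left_mono binomial_le_pow2) auto
  finally have "real (fact (a + n)) \<le> real (fact a * fact n * 2 ^ (a + n))"
    by (simp only: of_nat_le_iff)
  then have "sqrt (fact (a + n)) \<le> sqrt (2 ^ (a + n)) * (sqrt (fact a) * sqrt (fact n))"
    by (simp add: algebra_simps flip: real_sqrt_mult)
  also have "\<dots> \<le> 2 ^ (a + n) * (half_power a * half_power n)"
  proof (intro mult_mono sqrt_fact_le_half_power)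
    show "sqrt (2 ^ (a + n)) \<le> (2 :: real) ^ (a + n)"
      by (rule real_le_lsqrt) (auto simp: power2_eq_square)
  qed (auto simp: half_power_nonneg)
  finally have "2 ^ n * sqrt (fact (a + n)) \<le> 2 ^ (a + n) * (2 ^ (a + n) * (half_power a * half_power n))"
    by (intro mult_mono) auto
  also have "\<dots> = 4 ^ (a + n) * (half_power a * half_power n)"
    by (simp flip: power_mult_distrib mult.assoc)
  finally show ?thesis
    using abs_power_mult_gauss_deriv_le[of t a n] by linarith
qed

section \<open>Sequences of successive derivatives\<close>

lemma leibniz_sum_Suc:
  fixes u v :: "nat \<Rightarrow> 'a::comm_semiring_1"
  shows "(\<Sum>i\<le>Suc n. of_nat (Suc n choose i) * (u (Suc n - i) * v i)) =
    (\<Sum>i\<le>n. of_nat (n choose i) * (u (n - i) * v (Suc i) + u (Suc (n - i)) * v i))"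
proof -
  have "(\<Sum>i\<le>Suc n. of_nat (Suc n choose i) * (u (Suc n - i) * v i)) =
     u (Suc n) * v 0 + (\<Sum>i\<le>n. of_nat (n choose i) * (u (n - i) * v (Suc i)))
       + (\<Sum>i\<le>n. of_nat (n choose Suc i) * (u (n - i) * v (Suc i)))"
    by (subst sum.atMost_Suc_shift) (simp add: algebra_simps sum.distrib)
  also have "u (Suc n) * v 0 + (\<Sum>i\<le>n. of_nat (n choose i) * (u (n - i) * v (Suc i)))
       + (\<Sum>i\<le>n. of_nat (n choose Suc i) * (u (n - i) * v (Suc i)))
     = (\<Sum>i\<le>n. of_nat (n choose i) * (u (n - i) * v (Suc i)))
       + (\<Sum>i\<le>Suc n. of_nat (n choose i) * (u (Suc n - i) * v i))"
    unfolding sum.atMost_Suc_shift[of "\<lambda>i. of_nat (n choose i) * (u (Suc n - i) * v i)"]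
    by (simp add: add_ac binomial_eq_0)
  also have "(\<Sum>i\<le>Suc n. of_nat (n choose i) * (u (Suc n - i) * v i))
     = (\<Sum>i\<le>n. of_nat (n choose i) * (u (Suc (n - i)) * v i))"
    by (simp add: Suc_diff_le binomial_eq_0)
  finally show ?thesis
    by (simp add: sum.distrib distrib_left)
qed

lemma leibniz_has_vector_derivative:
  fixes u v :: "nat \<Rightarrow> real \<Rightarrow> complex"
  assumes "\<And>n t. (u n has_vector_derivative u (Suc n) t) (at t)"
    and "\<And>n t. (v n has_vector_derivative v (Suc n) t) (at t)"
  shows "((\<lambda>t. \<Sum>i\<le>n. of_nat (n choose i) * (u (n - i) t * v i t)) has_vector_derivative
     (\<Sum>i\<le>Suc n. of_nat (Suc n choose i) * (u (Suc n - i) t * v i t))) (at t)"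
  unfolding leibniz_sum_Suc[of n "\<lambda>i. u i t" "\<lambda>i. v i t"]
  by (intro has_vector_derivative_sum has_vector_derivative_mult_right
      has_vector_derivative_mult assms)

text \<open>With real frequencies every exponential has modulus \<open>1\<close> on the line, so that the coefficients
  dominate all derivatives uniformly in \<open>t\<close> and termwise differentiation is legitimate.\<close>

lemma exp_series_has_vector_derivative:
  fixes a m :: "nat \<Rightarrow> real"
  assumes "\<And>n. summable (\<lambda>k. \<bar>a k\<bar> * \<bar>m k\<bar> ^ n)"
  defines "\<theta> n t \<equiv> \<Sum>k. of_real (a k) * (\<i> * of_real (m k)) ^ n * exp (\<i> * of_real (m k) * of_real t)"
  shows "(\<theta> n has_vector_derivative \<theta> (Suc n) t) (at t)"
proof -
  define f where "f n k t = of_real (a k) * (\<i> * of_real (m k)) ^ n * exp (\<i> * of_real (m k) * of_real t)"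
    for n k t
  have nf: "norm (f n k t) \<le> \<bar>a k\<bar> * \<bar>m k\<bar> ^ n" for n k t
    by (simp add: f_def norm_mult norm_power)
  have df: "(f n k has_derivative (\<lambda>h. h *\<^sub>R f (Suc n) k t)) (at t within UNIV)" for n k t
  proof -
    have "((\<lambda>z. of_real (a k) * (\<i> * of_real (m k)) ^ n * exp (\<i> * of_real (m k) * z))
        has_field_derivative f (Suc n) k t) (at (of_real t))"
      by (auto intro!: derivative_eq_intros simp: f_def)
    then have "((\<lambda>t. of_real (a k) * (\<i> * of_real (m k)) ^ n * exp (\<i> * of_real (m k) * of_real t))
        has_vector_derivative f (Suc n) k t) (at t)"
      by (rule has_vector_derivative_real_field)
    then show ?thesis
      unfolding has_vector_derivative_def f_def[of n k, abs_def] by simp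
  qed
  have unif: "uniform_limit UNIV (\<lambda>N t. \<Sum>k<N. f n k t) (\<lambda>t. \<Sum>k. f n k t) sequentially" for n
    by (rule Weierstrass_m_test[OF nf assms(1)])
  have sums: "(\<lambda>k. f n k t) sums (\<Sum>k. f n k t)" for n t
    by (rule summable_sums, rule summable_comparison_test'[OF assms(1) nf])
  have "\<exists>g. \<forall>t\<in>UNIV. (\<lambda>k. f n k t) sums g t \<and>
      (g has_derivative (\<lambda>h. h *\<^sub>R (\<Sum>k. f (Suc n) k t))) (at t within UNIV)"
  proof (rule has_derivative_series[OF convex_UNIV df])
    fix e :: real assume "e > 0"
    have *: "(\<Sum>i<N. h *\<^sub>R f (Suc n) i x) - h *\<^sub>R (\<Sum>k. f (Suc n) k x)
        = h *\<^sub>R ((\<Sum>i<N. f (Suc n) i x) - (\<Sum>k. f (Suc n) k x))" for N h x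
      by (simp add: scaleR_sum_right algebra_simps)
    show "\<forall>\<^sub>F N in sequentially. \<forall>x\<in>UNIV. \<forall>h.
       norm ((\<Sum>i<N. h *\<^sub>R f (Suc n) i x) - h *\<^sub>R (\<Sum>k. f (Suc n) k x)) \<le> e * norm h"
      using uniform_limitD[OF unif[of "Suc n"] \<open>e > 0\<close>]
    proof eventually_elim
      case (elim N)
      show ?case
      proof (intro ballI allI)
        fix x h
        have "norm ((\<Sum>i<N. f (Suc n) i x) - (\<Sum>k. f (Suc n) k x)) \<le> e"
          using elim[rule_format, of x] by (simp add: dist_norm)
        then show "norm ((\<Sum>i<N. h *\<^sub>R f (Suc n) i x) - h *\<^sub>R (\<Sum>k. f (Suc n) k x)) \<le> e * norm h"
          unfolding * by (simp add: mult.commute[of e] mult_left_mono)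
      qed
    qed
  qed (use sums in auto)
  then obtain g where g: "\<And>t. (\<lambda>k. f n k t) sums g t"
    "\<And>t. (g has_derivative (\<lambda>h. h *\<^sub>R (\<Sum>k. f (Suc n) k t))) (at t)"
    by auto
  have "g = \<theta> n"
    using g(1) by (auto simp: \<theta>_def f_def sums_iff)
  then show ?thesis
    using g(2) by (simp add: has_vector_derivative_def \<theta>_def f_def)
qed

section \<open>A trigonometric series of prescribed growth\<close>

lemma log_convex_quotient_mono:
  fixes M :: "nat \<Rightarrow> real"
  assumes pos: "\<And>p. M p > 0" and lc: "\<And>p. (M (Suc p))\<^sup>2 \<le> M p * M (Suc (Suc p))"
    and "p \<le> q"
  shows "M (Suc p) / M p \<le> M (Suc q) / M q"
proof -
  have "M (Suc p) / M p \<le> M (Suc (Suc p)) / M (Suc p)" for p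
    using lc[of p] pos[of p] pos[of "Suc p"] by (simp add: field_simps power2_eq_square)
  then show ?thesis
    by (rule lift_Suc_mono_le[of "\<lambda>p. M (Suc p) / M p"]) fact
qed

text \<open>Raising \<open>b\<close> by one multiplies the left side by the quotient at \<open>b\<close> and the right side by the
  larger quotient at \<open>a + b\<close>.\<close>

lemma log_convex_mult_le_add:
  fixes M :: "nat \<Rightarrow> real"
  assumes pos: "\<And>p. M p > 0" and lc: "\<And>p. (M (Suc p))\<^sup>2 \<le> M p * M (Suc (Suc p))"
    and M0: "M 0 = 1"
  shows "M a * M b \<le> M (a + b)"
proof (induction b)
  case (Suc b)
  have "M a * M (Suc b) = (M a * M b) * (M (Suc b) / M b)"
    using pos[of b] by simp
  also have "\<dots> \<le> M (a + b) * (M (Suc (a + b)) / M (a + b))"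
    using Suc log_convex_quotient_mono[of M b "a + b", OF pos lc] pos
    by (intro mult_mono) (auto simp: less_imp_le)
  also have "\<dots> = M (a + Suc b)"
    using pos[of "a + b"] by simp
  finally show ?case .
qed (simp add: M0)

text \<open>Going from \<open>k\<close> to \<open>p\<close> multiplies \<open>M\<close> by the quotients in between. Since these increase, they
  are at least the one at \<open>k\<close> on the way up, and at most that one on the way down.\<close>

lemma log_convex_supporting_line:
  fixes M :: "nat \<Rightarrow> real"
  assumes pos: "\<And>p. M p > 0" and lc: "\<And>p. (M (Suc p))\<^sup>2 \<le> M p * M (Suc (Suc p))"
  shows "M k * (M (Suc k) / M k) ^ p \<le> M p * (M (Suc k) / M k) ^ k"
proof -
  define m where "m p = M (Suc p) / M p" for p
  have mpos: "m p > 0" for p using pos by (simp add: m_def)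
  have m: "M (Suc p) = m p * M p" for p using pos[of p] by (simp add: m_def)
  have mono: "m p \<le> m q" if "p \<le> q" for p q
    unfolding m_def by (rule log_convex_quotient_mono[of M, OF pos lc that])
  have "M k * m k ^ p \<le> M p * m k ^ k"
  proof (cases "k \<le> p")
    case True
    then show ?thesis
    proof (induction p rule: dec_induct)
      case (step p)
      have "M k * m k ^ Suc p = m k * (M k * m k ^ p)" by simp
      also have "\<dots> \<le> m p * (M p * m k ^ k)"
        using step mono[of k p] mpos pos by (intro mult_mono[of "m k"]) (auto simp: less_imp_le)
      finally show ?case by (simp add: m)
    qed simp
  next
    case False
    then have "p \<le> k" by simp
    then show ?thesis
    proof (induction p rule: inc_induct)
      case (step p)
      have "m k * (M k * m k ^ p) = M k * m k ^ Suc p" by simp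
      also have "\<dots> \<le> m p * (M p * m k ^ k)"
        using step by (simp add: m)
      also have "\<dots> \<le> m k * (M p * m k ^ k)"
        using step mono[of p k] mpos pos by (intro mult_right_mono) (auto simp: less_imp_le)
      finally show ?case using mpos by simp
    qed simp
  qed
  then show ?thesis by (simp add: m_def)
qed

text \<open>The weights \<open>(1/2)\<^sup>k\<close> make the series summable with sum \<open>2\<close> times the uniform bound on its
  terms, and only cost a factor \<open>2\<^sup>n\<close> in the lower bound at \<open>0\<close>, which comes from the term \<open>k = n\<close>,
  where the supporting line touches.\<close>

lemma exists_exp_series:
  fixes M :: "nat \<Rightarrow> real"
  assumes pos: "\<And>p. M p > 0" and lc: "\<And>p. (M (Suc p))\<^sup>2 \<le> M p * M (Suc (Suc p))"
  obtains \<theta> :: "nat \<Rightarrow> real \<Rightarrow> complex" and A :: "nat \<Rightarrow> real"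
  where "\<And>n t. (\<theta> n has_vector_derivative \<theta> (Suc n) t) (at t)"
    and "\<And>n t. norm (\<theta> n t) \<le> 2 * M n"
    and "\<And>n. \<theta> n 0 = \<i> ^ n * of_real (A n)" and "\<And>n. A n \<ge> M n / 2 ^ n"
proof -
  define m where "m k = M (Suc k) / M k" for k
  define a where "a k = (1/2) ^ k * (M k / m k ^ k)" for k
  define \<theta> where "\<theta> n t = (\<Sum>k. of_real (a k) * (\<i> * of_real (m k)) ^ n * exp (\<i> * of_real (m k) * of_real t))"
    for n :: nat and t :: real
  define A where "A n = (\<Sum>k. a k * m k ^ n)" for n
  have mpos: "m k > 0" for k using pos by (simp add: m_def)
  have apos: "a k > 0" for k using pos mpos by (simp add: a_def)
  have le: "a k * m k ^ n \<le> M n * (1/2) ^ k" for k n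
  proof -
    have "M k * m k ^ n / m k ^ k \<le> M n"
      using log_convex_supporting_line[of M k n, OF pos lc] mpos[of k]
      by (simp add: m_def[symmetric] pos_divide_le_eq)
    then have "(1/2) ^ k * (M k * m k ^ n / m k ^ k) \<le> (1/2) ^ k * M n"
      by (intro mult_left_mono) auto
    then show ?thesis by (simp add: a_def mult_ac)
  qed
  have geo: "(\<lambda>k. M n * (1/2) ^ k) sums (M n * 2)" for n
    using sums_mult[OF geometric_sums[of "1/2::real"], of "M n"] by simp
  have summ: "summable (\<lambda>k. a k * m k ^ n)" for n
    by (rule summable_comparison_test'[OF sums_summable[OF geo[of n]]])
       (use le apos mpos in \<open>auto simp: abs_mult less_imp_le\<close>)
  have summ': "summable (\<lambda>k. \<bar>a k\<bar> * \<bar>m k\<bar> ^ n)" for n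
    using summ[of n] apos mpos by (simp add: less_imp_le)
  have A2: "A n \<le> 2 * M n" for n
    using suminf_le[OF le summ sums_summable[OF geo]] sums_unique[OF geo[of n]]
    by (simp add: A_def mult.commute)
  show thesis
  proof
    show "(\<theta> n has_vector_derivative \<theta> (Suc n) t) (at t)" for n t
      using exp_series_has_vector_derivative[OF summ'] unfolding \<theta>_def .
    show "norm (\<theta> n t) \<le> 2 * M n" for n t
    proof -
      have "norm (\<theta> n t) \<le> A n"
        unfolding \<theta>_def A_def
        by (rule norm_suminf_le[OF _ summ])
          (use apos mpos in \<open>auto simp: norm_mult norm_power less_imp_le\<close>)
      with A2[of n] show ?thesis by simp
    qed
    show "\<theta> n 0 = \<i> ^ n * of_real (A n)" for n
    proof -
      have "\<theta> n 0 = (\<Sum>k. \<i> ^ n * of_real (a k * m k ^ n))"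
        by (simp add: \<theta>_def power_mult_distrib mult_ac)
      also have "\<dots> = \<i> ^ n * of_real (A n)"
        unfolding A_def suminf_of_real[OF summ]
        by (rule suminf_mult) (rule summable_of_real[OF summ])
      finally show ?thesis .
    qed
    show "A n \<ge> M n / 2 ^ n" for n
    proof -
      have "(\<Sum>k\<in>{n}. a k * m k ^ n) \<le> A n"
        unfolding A_def by (rule sum_le_suminf[OF summ]) (use apos mpos in \<open>auto simp: less_imp_le\<close>)
      moreover have "a n * m n ^ n = M n / 2 ^ n"
        using mpos[of n] by (simp add: a_def field_simps)
      ultimately show ?thesis by simp
    qed
  qed
qed

section \<open>An optimal function in one variable\<close>

text \<open>\<open>F n\<close> is the \<open>n\<close>-th derivative, by Leibniz' rule, of the Gaussian times the series from the
  previous lemma. The weight \<open>L\<close> is meant to be a later member of the same weight matrix as \<open>M\<close>;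
  the hypothesis relating them is \<open>R1\<close> in one variable.\<close>

lemma exists_optimal_function:
  fixes M L :: "nat \<Rightarrow> real"
  assumes pos: "\<And>p. M p > 0" and lc: "\<And>p. (M (Suc p))\<^sup>2 \<le> M p * M (Suc (Suc p))"
    and M0: "M 0 = 1"
    and posL: "\<And>p. L p > 0" 
    and R1: "\<And>p q. half_power p * M q \<le> B * C ^ p * H ^ (p + q) * L (p + q)"
    and BCH: "B > 0" "C > 0" "H > 0"
  obtains F :: "nat \<Rightarrow> real \<Rightarrow> complex" and K h :: real
  where "\<And>n t. (F n has_vector_derivative F (Suc n) t) (at t)"
    and "h > 0"
    and "\<And>a b t. \<bar>t\<bar> ^ a * norm (F b t) \<le> K * (h ^ (a + b) * (L a * L b))"
    and "\<And>n. M n / 2 ^ n \<le> norm (F n 0)"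
proof -
  obtain \<theta> :: "nat \<Rightarrow> real \<Rightarrow> complex" and A
    where d\<theta>: "\<And>n t. (\<theta> n has_vector_derivative \<theta> (Suc n) t) (at t)"
    and \<theta>: "\<And>n t. norm (\<theta> n t) \<le> 2 * M n"
    and \<theta>0: "\<And>n. \<theta> n 0 = \<i> ^ n * of_real (A n)" and A: "\<And>n. A n \<ge> M n / 2 ^ n"
    using exists_exp_series[of M, OF pos lc] by blast
  define F where "F = (\<lambda>n t. \<Sum>i\<le>n. of_nat (n choose i) * (of_real (gauss_deriv (n - i) t) * \<theta> i t))"
  define c where "c = max C 1 * H"
  have c: "c > 0" using BCH by (simp add: c_def)
  have A0: "A n \<ge> 0" for n
    using A[of n] pos[of n] by (meson divide_nonneg_pos less_imp_le order_trans zero_less_numeral zero_less_power)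
  \<comment> \<open>It is enough to keep one geometric factor: with \<open>max C 1\<close> in place of \<open>C\<close> the exponent \<open>p\<close> may
    be raised to \<open>p + q\<close>.\<close>
  have R1': "half_power p * M q \<le> B * c ^ (p + q) * L (p + q)" for p q
  proof -
    have "C ^ p \<le> max C 1 ^ p"
      using BCH by (intro power_mono) auto
    also have "\<dots> \<le> max C 1 ^ (p + q)"
      by (rule power_increasing) auto
    finally have "B * C ^ p * H ^ (p + q) * L (p + q) \<le> B * max C 1 ^ (p + q) * H ^ (p + q) * L (p + q)"
      using BCH posL[of "p + q"] by (intro mult_right_mono mult_left_mono) auto
    with R1[of p q] show ?thesis
      by (simp add: c_def power_mult_distrib mult.assoc)
  qed
  have dgauss: "((\<lambda>t. complex_of_real (gauss_deriv n t)) has_vector_derivative of_real (gauss_deriv (Suc n) t)) (at t)"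
    for n t
    using gauss_deriv_has_real_derivative[of n t]
    by (intro has_vector_derivative_of_real) (simp add: has_real_derivative_iff_has_vector_derivative)
  have dF: "(F n has_vector_derivative F (Suc n) t) (at t)" for n t
    unfolding F_def
    by (rule leibniz_has_vector_derivative[of "\<lambda>n t. of_real (gauss_deriv n t)" \<theta>, OF dgauss d\<theta>])
  have bound: "\<bar>t\<bar> ^ a * norm (F b t) \<le> (2 * B * B) * ((8 * c) ^ (a + b) * (L a * L b))" for a b t
  proof -
    define D where "D = 2 * B * B * ((4 * c) ^ (a + b) * (L a * L b))"
    have D: "D \<ge> 0"
      using BCH c posL by (simp add: D_def less_imp_le)
    have "\<bar>t\<bar> ^ a * norm (F b t)
        \<le> \<bar>t\<bar> ^ a * (\<Sum>i\<le>b. real (b choose i) * (\<bar>gauss_deriv (b - i) t\<bar> * norm (\<theta> i t)))"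
      unfolding F_def
      by (intro mult_left_mono order_trans[OF norm_sum] sum_mono) (auto simp: norm_mult)
    also have "\<dots> = (\<Sum>i\<le>b. real (b choose i) * (\<bar>t\<bar> ^ a * \<bar>gauss_deriv (b - i) t\<bar> * norm (\<theta> i t)))"
      by (simp add: sum_distrib_left mult_ac)
    also have "\<dots> \<le> (\<Sum>i\<le>b. real (b choose i) * D)"
    proof (intro sum_mono mult_left_mono)
      fix i assume "i \<in> {..b}"
      then have i: "i \<le> b" by simp
      have "\<bar>t\<bar> ^ a * \<bar>gauss_deriv (b - i) t\<bar> * norm (\<theta> i t)
          \<le> (4 ^ (a + (b - i)) * (half_power a * half_power (b - i))) * (2 * M i)"
        by (intro mult_mono abs_power_mult_gauss_deriv_le_half_power \<theta>) (auto simp: half_power_nonneg)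
      \<comment> \<open>The half power belonging to \<open>t\<^sup>a\<close> is absorbed alone, paired with \<open>M 0 = 1\<close>; the other
        one is absorbed together with \<open>M i\<close>, which raises the index to \<open>b\<close>.\<close>
      also have "\<dots> = 2 * 4 ^ (a + (b - i)) * ((half_power a * M 0) * (half_power (b - i) * M i))"
        by (simp add: M0)
      also have "\<dots> \<le> 2 * 4 ^ (a + b) * ((B * c ^ a * L a) * (B * c ^ b * L b))"
      proof (rule mult_mono)
        have "half_power a * M 0 \<le> B * c ^ a * L a"
          using R1'[of a 0] by (simp only: add_0_right)
        moreover have "half_power (b - i) * M i \<le> B * c ^ b * L b"
          using R1'[of "b - i" i] by (simp only: le_add_diff_inverse2[OF i])
        ultimately show "(half_power a * M 0) * (half_power (b - i) * M i)
            \<le> (B * c ^ a * L a) * (B * c ^ b * L b)"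
          by (rule mult_mono)
            (intro mult_nonneg_nonneg zero_le_power half_power_nonneg
              less_imp_le[OF pos] less_imp_le[OF posL] less_imp_le[OF c] less_imp_le[OF BCH(1)])+
        show "(2::real) * 4 ^ (a + (b - i)) \<le> 2 * 4 ^ (a + b)"
          by (intro mult_left_mono power_increasing) auto
        show "0 \<le> half_power a * M 0 * (half_power (b - i) * M i)"
          by (intro mult_nonneg_nonneg half_power_nonneg less_imp_le[OF pos])
      qed simp
      also have "\<dots> = D"
        by (simp add: D_def power_add power_mult_distrib)
      finally show "\<bar>t\<bar> ^ a * \<bar>gauss_deriv (b - i) t\<bar> * norm (\<theta> i t) \<le> D" .
    qed auto
    also have "\<dots> = 2 ^ b * D"
      using choose_row_sum[of b] by (simp flip: sum_distrib_right of_nat_sum)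
    also have "\<dots> \<le> 2 ^ (a + b) * D"
      using D by (intro mult_right_mono power_increasing) auto
    also have "\<dots> = (2 * B * B) * ((8 * c) ^ (a + b) * (L a * L b))"
    proof -
      have "8 * c = 2 * (4 * c)" by simp
      then have "(8 * c) ^ (a + b) = 2 ^ (a + b) * (4 * c) ^ (a + b)"
        by (simp only: power_mult_distrib)
      then show ?thesis unfolding D_def by (simp only: mult_ac)
    qed
    finally show ?thesis .
  qed
  have lower: "M n / 2 ^ n \<le> norm (F n 0)" for n
  proof -
    \<comment> \<open>All terms have the direction \<open>\<i> ^ n\<close>, so the modulus is at least that of the single term
      \<open>i = n\<close>, in which the Gaussian is not differentiated.\<close>
    have "F n 0 = (\<Sum>i\<le>n. \<i> ^ n * of_real (real (n choose i) * (gauss_moment (n - i) * A i)))"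
      unfolding F_def
    proof (intro sum.cong refl)
      fix i assume "i \<in> {..n}"
      then have "\<i> ^ n = \<i> ^ (n - i) * \<i> ^ i"
        by (simp flip: power_add)
      then show "of_nat (n choose i) * (of_real (gauss_deriv (n - i) 0) * \<theta> i 0) =
          \<i> ^ n * of_real (real (n choose i) * (gauss_moment (n - i) * A i))"
        by (simp add: gauss_deriv_0 \<theta>0)
    qed
    also have "\<dots> = \<i> ^ n * of_real (\<Sum>i\<le>n. real (n choose i) * (gauss_moment (n - i) * A i))"
      by (simp add: sum_distrib_left)
    finally have "norm (F n 0) = \<bar>\<Sum>i\<le>n. real (n choose i) * (gauss_moment (n - i) * A i)\<bar>"
      by (simp add: norm_mult norm_power del: of_real_sum)
    moreover have "(\<Sum>i\<in>{n}. real (n choose i) * (gauss_moment (n - i) * A i))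
        \<le> (\<Sum>i\<le>n. real (n choose i) * (gauss_moment (n - i) * A i))"
      by (rule sum_mono2) (auto simp: gauss_moment_nonneg A0)
    ultimately show ?thesis using A[of n] by simp
  qed
  show thesis
  proof
    show "(F n has_vector_derivative F (Suc n) t) (at t)" for n t by (rule dF)
    show "8 * c > 0" using c by simp
    show "\<bar>t\<bar> ^ a * norm (F b t) \<le> (2 * B * B) * ((8 * c) ^ (a + b) * (L a * L b))" for a b t
      by (rule bound)
    show "M n / 2 ^ n \<le> norm (F n 0)" for n by (rule lower)
  qed
qed

section \<open>Functions on a one-dimensional space\<close>

text \<open>When the index type has the single element \<open>j\<close>, functions on \<open>real ^ 'n\<close> are functions of the
  coordinate \<open>x $ j\<close>, and every iterated partial derivative is an ordinary one.\<close>

lemma partial_component: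
  fixes j :: "'n::finite"
  assumes j: "\<And>i :: 'n. i = j"
    and "\<And>t. (F has_vector_derivative F' t) (at t)"
  shows "((\<lambda>x :: real ^ 'n. F (x $ j)) has_derivative (\<lambda>h. (h $ j) *\<^sub>R F' (x $ j))) (at x)"
    and "partial i (\<lambda>x :: real ^ 'n. F (x $ j)) = (\<lambda>x. F' (x $ j))"
proof -
  show d: "((\<lambda>x :: real ^ 'n. F (x $ j)) has_derivative (\<lambda>h. (h $ j) *\<^sub>R F' (x $ j))) (at x)" for x
  proof -
    have "((\<lambda>x :: real ^ 'n. x $ j) has_derivative (\<lambda>h. h $ j)) (at x)"
      by (rule bounded_linear.has_derivative[OF bounded_linear_vec_nth]) simp
    from has_derivative_compose[OF this assms(2)[unfolded has_vector_derivative_def]]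
    show ?thesis .
  qed
  have "i = j" by (rule j)
  then show "partial i (\<lambda>x :: real ^ 'n. F (x $ j)) = (\<lambda>x. F' (x $ j))"
    by (auto simp: partial_def fun_eq_iff simp flip: frechet_derivative_at[OF d])
qed

lemma foldr_partial_component:
  fixes j :: "'n::finite"
  assumes j: "\<And>i :: 'n. i = j"
    and F: "\<And>n t. (F n has_vector_derivative F (Suc n) t) (at t)"
  shows "foldr partial js (\<lambda>x :: real ^ 'n. F 0 (x $ j)) = (\<lambda>x. F (length js) (x $ j))"
  by (induction js) (simp_all add: partial_component(2)[OF j F])

lemma smooth_component:
  fixes j :: "'n::finite"
  assumes j: "\<And>i :: 'n. i = j"
    and F: "\<And>n t. (F n has_vector_derivative F (Suc n) t) (at t)"
  shows "smooth (\<lambda>x :: real ^ 'n. F 0 (x $ j))"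
  unfolding smooth_def foldr_partial_component[where j = j and F = F, OF j F]
  using partial_component(1)[OF j F] by (blast intro: differentiableI)

lemma mi_deriv_component:
  fixes j :: "'n::finite"
  assumes j: "\<And>i :: 'n. i = j"
    and F: "\<And>n t. (F n has_vector_derivative F (Suc n) t) (at t)"
  shows "mi_deriv \<beta> (\<lambda>x :: real ^ 'n. F 0 (x $ j)) x = F (\<beta> $ j) (x $ j)"
proof -
  have "count_list js j = length js" for js :: "'n list"
    using j by (induction js) auto
  then have "length (mi_list \<beta>) = \<beta> $ j"
    using count_list_mi_list[of \<beta> j] by simp
  then show ?thesis
    by (simp add: mi_deriv_def foldr_partial_component[where j = j and F = F, OF j F])
qed

section \<open>Inclusions between the spaces\<close>

lemma S_norm_le_of_seq_le:
  fixes M N :: "real \<Rightarrow> nat ^ 'n::finite \<Rightarrow> real"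
  assumes M: "weight_matrix M" and N: "weight_matrix N" and l: "l > 0" and k: "k > 0" and h: "h > 0"
    and C: "C \<ge> 1" "\<And>\<alpha>. M l \<alpha> \<le> C ^ mi_abs \<alpha> * N k \<alpha>"
  shows "S_norm g (N k) (C * h) f \<le> S_norm g (M l) h f"
  unfolding S_norm_def
proof (rule SUP_mono', clarify)
  fix \<alpha> \<beta> :: "nat ^ 'n"
  have add: "mi_abs (\<alpha> + \<beta>) = mi_abs \<alpha> + mi_abs \<beta>"
    by (simp add: mi_abs_def sum.distrib)
  have pos: "M l \<beta> > 0" "N k \<alpha> > 0" "M l \<alpha> > 0"
    using M N l k by (auto simp: weight_matrix_def)
  have "growth_weight g (M l) \<alpha> \<beta> \<le> C ^ mi_abs (\<alpha> + \<beta>) * growth_weight g (N k) \<alpha> \<beta>"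
  proof (cases g)
    case Separated
    have "M l \<alpha> * M l \<beta> \<le> (C ^ mi_abs \<alpha> * N k \<alpha>) * (C ^ mi_abs \<beta> * N k \<beta>)"
      using C pos by (intro mult_mono) auto
    then show ?thesis by (simp add: Separated add power_add mult_ac)
  qed (use C in simp)
  then have "h ^ mi_abs (\<alpha> + \<beta>) * growth_weight g (M l) \<alpha> \<beta>
      \<le> (C * h) ^ mi_abs (\<alpha> + \<beta>) * growth_weight g (N k) \<alpha> \<beta>" (is "?m \<le> ?n")
    using h by (simp add: power_mult_distrib mult_ac mult_left_mono)
  moreover have "?m > 0"
    using h growth_weight_pos[OF M l] by simp
  ultimately have "inverse (ennreal ?n) \<le> inverse (ennreal ?m)"
    using le_imp_inverse_le[of ?m ?n]
    by (simp add: inverse_ennreal ennreal_leI del: inverse_mult_distrib)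
  then show "sup_norm (\<lambda>x. of_real (monomial x \<alpha>) * mi_deriv \<beta> f x) / ennreal ?n
      \<le> sup_norm (\<lambda>x. of_real (monomial x \<alpha>) * mi_deriv \<beta> f x) / ennreal ?m"
    unfolding divide_ennreal_def by (rule mult_left_mono) simp
qed

text \<open>The trace on the smaller space of a zero neighbourhood of the larger one is absolutely convex
  and contains a ball of each step, because that step maps with norm at most \<open>1\<close> into a step of
  the larger space. Continuity of the inclusion follows since all topologies are translation
  invariant.\<close>

lemma continuously_included_if_matrix_le:
  assumes M: "weight_matrix M" and N: "weight_matrix N" and le: "matrix_le M N"
  shows "continuously_included g M N"
proof -
  have step: "\<exists>k>0. \<exists>h'>0. \<forall>f. S_norm g (N k) h' f \<le> S_norm g (M l) h f" if "l > 0" "h > 0" for l h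
  proof -
    obtain k C where "k > 0" "C \<ge> 1" "\<And>\<alpha>. M l \<alpha> \<le> C ^ mi_abs \<alpha> * N k \<alpha>"
      using le \<open>l > 0\<close> unfolding matrix_le_def seq_le_def by blast
    with S_norm_le_of_seq_le[OF M N \<open>l > 0\<close> this(1) \<open>h > 0\<close> this(2,3)] that show ?thesis
      by (intro exI[of _ k] conjI exI[of _ "C * h"]) auto
  qed
  have sub: "S_space g M \<subseteq> S_space g N"
  proof
    fix f assume "f \<in> S_space g M"
    then obtain l h where "smooth f" "l > 0" "h > 0" "S_norm g (M l) h f < \<infinity>"
      unfolding S_space_def by blast
    with step[of l h] show "f \<in> S_space g N"
      unfolding S_space_def by (auto intro: le_less_trans)
  qed
  have nbhd: "S_zero_nbhd g M (U \<inter> S_space g M)" if U: "S_zero_nbhd g N U" for U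
    unfolding S_zero_nbhd_def
  proof (intro conjI allI impI)
    show "absolutely_convex (U \<inter> S_space g M)"
      using U S_space_lincomb[OF M] unfolding S_zero_nbhd_def absolutely_convex_def by blast
    fix l h :: real assume lh: "l > 0" "h > 0"
    then obtain k h' where k: "k > 0" "h' > 0" and n: "\<And>f. S_norm g (N k) h' f \<le> S_norm g (M l) h f"
      using step by blast
    then obtain e where "e > 0"
      and e: "\<And>f. f \<in> S_step g (N k) h' \<Longrightarrow> S_norm g (N k) h' f < ennreal e \<Longrightarrow> f \<in> U"
      using U unfolding S_zero_nbhd_def by blast
    have "f \<in> U \<inter> S_space g M"
      if f: "f \<in> S_step g (M l) h" "S_norm g (M l) h f < ennreal e" for f
    proof
      show "f \<in> U"
        using f n[of f] by (intro e) (auto simp: S_step_def intro: le_less_trans)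
      show "f \<in> S_space g M"
        using f lh by (auto simp: S_step_def S_space_def)
    qed
    with \<open>e > 0\<close> show "\<exists>e>0. \<forall>f\<in>S_step g (M l) h. S_norm g (M l) h f < ennreal e \<longrightarrow> f \<in> U \<inter> S_space g M"
      by blast
  qed auto
  have "S_open g M (W \<inter> S_space g M)" if W: "S_open g N W" for W
    unfolding S_open_def
  proof (intro conjI ballI)
    fix f assume f: "f \<in> W \<inter> S_space g M"
    then obtain U where U: "S_zero_nbhd g N U" "\<And>u. u \<in> U \<Longrightarrow> (\<lambda>x. f x + u x) \<in> W"
      using W unfolding S_open_def by blast
    have "(\<lambda>x. f x + u x) \<in> S_space g M" if "u \<in> S_space g M" for u
      using S_space_lincomb[OF M _ that, of f 1 1] f by simp
    with U show "\<exists>U. S_zero_nbhd g M U \<and> (\<forall>u\<in>U. (\<lambda>x. f x + u x) \<in> W \<inter> S_space g M)"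
      using nbhd[OF U(1)] by (intro exI[of _ "U \<inter> S_space g M"]) auto
  qed auto
  moreover have "{f \<in> S_space g M. id f \<in> W} = W \<inter> S_space g M" for W
    by auto
  ultimately have "continuous_map (S_topology g M) (S_topology g N) id"
    unfolding continuous_map_def topspace_S_topology[OF M] topspace_S_topology[OF N] openin_S_topology
    using sub by auto
  with sub show ?thesis
    by (simp add: continuously_included_def)
qed

text \<open>The optimal function for \<open>M l\<close> is tested in the seminorm of \<open>N\<close> in which it is finite. Taking
  the multi-index of the monomial to be \<open>0\<close> makes joint and separated weights agree, since
  \<open>N k 0 = 1\<close>.\<close>

lemma matrix_le_if_S_space_subset:
  fixes M N :: "real \<Rightarrow> nat ^ 'n::finite \<Rightarrow> real"
  assumes M: "weight_matrix M" and N: "weight_matrix N"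
    and dim: "CARD('n) = 1" and lc: "standard_log_convex M" and R1: "R1 M"
    and sub: "S_space g M \<subseteq> S_space g N"
  shows "matrix_le M N"
  unfolding matrix_le_def
proof (intro allI impI)
  fix l :: real assume l: "l > 0"
  obtain j :: 'n where UN: "UNIV = {j}"
    using dim card_1_singletonE by blast
  then have j: "i = j" for i :: 'n by blast
  have vec: "vec (\<alpha> $ j) = \<alpha>" for \<alpha> :: "nat ^ 'n"
    unfolding vec_eq_iff using j by (metis vec_component)
  have abs: "mi_abs \<alpha> = \<alpha> $ j" for \<alpha> :: "nat ^ 'n"
    by (simp add: mi_abs_def UN)
  have half: "mi_half_power \<alpha> = half_power (\<alpha> $ j)" for \<alpha> :: "nat ^ 'n"
    by (simp add: mi_half_power_def half_power_def UN)
  have vadd: "vec p + vec q = (vec (p + q) :: nat ^ 'n)" for p q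
    by (simp add: vec_eq_iff)
  have vec0: "vec 0 = (0 :: nat ^ 'n)"
    by (simp add: vec_eq_iff)
  obtain k B C H where k: "k \<ge> l" and BCH: "B > 0" "C > 0" "H > 0"
    and r: "\<And>\<alpha> \<beta>. mi_half_power \<alpha> * M l \<beta> \<le> B * C ^ mi_abs \<alpha> * H ^ mi_abs (\<alpha> + \<beta>) * M k (\<alpha> + \<beta>)"
    using R1 l unfolding R1_def by blast
  have k0: "k > 0" using k l by simp
  have LC: "(\<lambda>p. M r (vec p)) \<in> LC" if "r > 0" for r
    using lc that by (simp add: standard_log_convex_def)
  have conv: "(M r (vec (Suc p)))\<^sup>2 \<le> M r (vec p) * M r (vec (Suc (Suc p)))" if "r > 0" for r p
  proof -
    have "\<forall>p\<ge>1. (M r (vec p))\<^sup>2 \<le> M r (vec (p - 1)) * M r (vec (p + 1))"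
      using LC[OF that] unfolding LC_def by blast
    from this[rule_format, of "Suc p"] show ?thesis by simp
  qed
  have pos: "M r \<alpha> > 0" "N r \<alpha> > 0" "M r 0 = 1" "N r 0 = 1" if "r > 0" for r \<alpha>
    using M N that by (auto simp: weight_matrix_def)
  have M0: "M l (vec 0) = 1"
    using pos(3)[OF l] by (simp only: vec0)
  have growth: "half_power p * M l (vec q) \<le> B * C ^ p * H ^ (p + q) * M k (vec (p + q))" for p q
    using r[of "vec p" "vec q"] by (simp add: half abs vadd)
  obtain F :: "nat \<Rightarrow> real \<Rightarrow> complex" and K h
    where dF: "\<And>n t. (F n has_vector_derivative F (Suc n) t) (at t)" and h: "h > 0"
    and F: "\<And>a b t. \<bar>t\<bar> ^ a * norm (F b t) \<le> K * (h ^ (a + b) * (M k (vec a) * M k (vec b)))"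
    and F0: "\<And>n. M l (vec n) / 2 ^ n \<le> norm (F n 0)"
    by (rule exists_optimal_function[of "\<lambda>p. M l (vec p)" "\<lambda>p. M k (vec p)" B C H,
          OF pos(1)[OF l] conv[OF l] M0 pos(1)[OF k0] growth BCH]) (rule that)
  define f where "f x = F 0 (x $ j)" for x :: "real ^ 'n"
  have df: "mi_deriv \<beta> f x = F (\<beta> $ j) (x $ j)" for \<beta> x
    unfolding f_def by (rule mi_deriv_component[where j = j and F = F, OF j dF])
  have sup: "M k (vec a) * M k (vec b) \<le> M k (vec (a + b))" for a b
    by (rule log_convex_mult_le_add[of "\<lambda>p. M k (vec p)"]) (use pos[OF k0] conv[OF k0] in \<open>auto simp: vec0\<close>)
  have "f \<in> S_space g M"
  proof -
    have "K \<ge> 0"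
      using order_trans[OF _ F[of 0 0 0]] pos[OF k0] by (simp add: vec0)
    have "norm (of_real (monomial x \<alpha>) * mi_deriv \<beta> f x)
           \<le> K * (h ^ mi_abs (\<alpha> + \<beta>) * growth_weight g (M k) \<alpha> \<beta>)" for \<alpha> \<beta> x
    proof -
      have "M k \<alpha> * M k \<beta> \<le> growth_weight g (M k) \<alpha> \<beta>"
        using sup[of "\<alpha> $ j" "\<beta> $ j"] by (cases g) (simp_all add: vec flip: vadd)
      then have "K * (h ^ mi_abs (\<alpha> + \<beta>) * (M k \<alpha> * M k \<beta>))
          \<le> K * (h ^ mi_abs (\<alpha> + \<beta>) * growth_weight g (M k) \<alpha> \<beta>)"
        using \<open>K \<ge> 0\<close> h by (intro mult_left_mono) auto
      moreover have "norm (of_real (monomial x \<alpha>) * mi_deriv \<beta> f x)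
          \<le> K * (h ^ mi_abs (\<alpha> + \<beta>) * (M k \<alpha> * M k \<beta>))"
        using F[of "x $ j" "\<alpha> $ j" "\<beta> $ j"]
        by (simp add: df monomial_def UN norm_mult norm_power abs vec)
      ultimately show ?thesis by linarith
    qed
    then have "S_norm g (M k) h f < \<infinity>"
      unfolding S_norm_finite_iff[OF M k0 h] by blast
    with k0 h smooth_component[where j = j and F = F, OF j dF] show ?thesis
      by (auto simp: S_space_def f_def[abs_def])
  qed
  then have "f \<in> S_space g N" using sub by blast
  then obtain k' h' D where k': "k' > 0" and h': "h' > 0"
    and D: "\<And>\<alpha> \<beta> x. norm (of_real (monomial x \<alpha>) * mi_deriv \<beta> f x)
           \<le> D * (h' ^ mi_abs (\<alpha> + \<beta>) * growth_weight g (N k') \<alpha> \<beta>)"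
    by (elim S_spaceE[OF N]) blast
  \<comment> \<open>For \<open>mi_abs \<alpha> \<ge> 1\<close> the constant \<open>D\<close> is absorbed into the geometric factor, and for \<open>\<alpha> = 0\<close>
    both weights are \<open>1\<close>.\<close>
  define E where "E = max 1 D * max 1 (2 * h')"
  have E: "E \<ge> 1" unfolding E_def using mult_mono[of 1 "max 1 D" 1 "max 1 (2 * h')"] by simp
  have "M l \<alpha> \<le> E ^ mi_abs \<alpha> * N k' \<alpha>" for \<alpha>
  proof (cases "\<alpha> $ j = 0")
    case True
    then have "\<alpha> = 0" using vec vec0 by metis
    then show ?thesis using pos l k' by (simp add: mi_abs_def)
  next
    case False
    define p where "p = \<alpha> $ j"
    have "growth_weight g (N k') 0 \<alpha> = N k' \<alpha>"
      using pos k' by (cases g) auto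
    then have "norm (F p 0) \<le> D * (h' ^ p * N k' \<alpha>)"
      using D[of 0 0 \<alpha>] by (simp add: df monomial_def abs p_def)
    then have "M l \<alpha> / 2 ^ p \<le> D * (h' ^ p * N k' \<alpha>)"
      using F0[of p] by (simp add: p_def vec)
    then have "M l \<alpha> \<le> D * (2 * h') ^ p * N k' \<alpha>"
      by (simp add: field_simps)
    also have "\<dots> \<le> (max 1 D ^ p * max 1 (2 * h') ^ p) * N k' \<alpha>"
    proof (intro mult_right_mono mult_mono)
      show "D \<le> max 1 D ^ p"
        using False self_le_power[of "max 1 D" p] by (simp add: p_def)
      show "(2 * h') ^ p \<le> max 1 (2 * h') ^ p"
        using h' by (intro power_mono) auto
    qed (use h' pos k' in \<open>auto simp: less_imp_le\<close>)
    finally show ?thesis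
      by (simp add: E_def power_mult_distrib abs p_def)
  qed
  with k' E show "\<exists>k>0. seq_le (M l) (N k)"
    unfolding seq_le_def by blast
qed

theorem theorem4p4:
  fixes M N :: "real \<Rightarrow> nat ^ 'n::finite \<Rightarrow> real"
  assumes "weight_matrix M" and "weight_matrix N"
  shows "(\<forall>g. matrix_le M N \<longrightarrow> continuously_included g M N) \<and>
    (CARD('n) = 1 \<longrightarrow> standard_log_convex M \<longrightarrow> standard_log_convex N \<longrightarrow>
     R1 M \<longrightarrow> R2 M \<longrightarrow> R1 N \<longrightarrow> R2 N \<longrightarrow>
     (\<forall>g. continuously_included g M N \<longrightarrow> matrix_le M N))"
  using continuously_included_if_matrix_le[OF assms] matrix_le_if_S_space_subset[OF assms]
  by (auto simp: continuously_included_def)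

end
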